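(* There is an absolute constant $C>0$ such that the following holds. Let $\mathcal{P}=\{x\in\mathbb{R}^d\mid Ax\le c\}$ be a polytope with $A\in\mathbb{Z}^{m\times d}$, $c\in\mathbb{Z}^m_{\ge0}$, and let $V_I\subseteq\mathcal{P}\cap\mathbb{Z}^d$ be the set of vertices of the integer polytope $\mathcal{P}_I=\mathrm{Conv}(\mathcal{P}\cap\mathbb{Z}^d)$ (so $\mathrm{Conv}(V_I)\cap\mathbb{Z}^d=\mathcal{P}\cap\mathbb{Z}^d$). Then for every vector $b\in\mathrm{int.cone}(\mathcal{P}\cap\mathbb{Z}^d)$ there exists an integral vector $\lambda\in\mathbb{Z}_{\ge0}^{\mathcal{P}\cap\mathbb{Z}^d}$ with $b=\sum_{p\in\mathcal{P}\cap\mathbb{Z}^d}\lambda_p p$ such that (1) $\lambda_p\le 2^{2^{Cd}}$ for all $p\in(\mathcal{P}\cap\mathbb{Z}^d)\setminus V_I$, (2) $|\mathrm{supp}(\lambda)\cap V_I|\le d\cdot 2^d$, (3) $|\mathrm{supp}(\lambda)\setminus V_I|\le 2^{2d}$.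
   Context: $\mathrm{int.cone}(\mathcal{P}\cap\mathbb{Z}^d)=\{\sum_{p\in\mathcal{P}\cap\mathbb{Z}^d}\lambda_p p \mid \lambda\in\mathbb{Z}_{\ge0}^{\mathcal{P}\cap\mathbb{Z}^d}\}$. $\mathrm{Conv}(X)$ is the convex hull of $X$. For a vector $\lambda$ indexed by a set $M$, $\mathrm{supp}(\lambda)=\{s\in M\mid\lambda_s\ne0\}$. *)

theory Defs
  imports "HOL-Analysis.Analysis" "HOL-Analysis.Finite_Function_Topology"
begin

text \<open>
  The constant in the theorem must not depend on the dimension \<open>d\<close>, so \<open>d\<close> has to be a
  number rather than a type. The space \<open>\<real>\<^sup>d\<close> is therefore the subspace of those finitely supported
  functions on the natural numbers that vanish outside \<open>{..<d}\<close>. These functions form a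
  \<open>real_normed_vector\<close>, so convex hulls, extreme points and \<open>polytope\<close> are the library notions.
\<close>

type_synonym rvec = "nat \<Rightarrow>\<^sub>0 real"

definition Rspace :: "nat \<Rightarrow> rvec set" where
  "Rspace d = {x. Poly_Mapping.keys x \<subseteq> {..<d}}"

definition Zlattice :: "nat \<Rightarrow> rvec set" where
  "Zlattice d = {x \<in> Rspace d. \<forall>j<d. Poly_Mapping.lookup x j \<in> \<int>}"

text \<open>
  \<open>{x \<in> \<real>\<^sup>d. A x \<le> c}\<close> for an \<open>m \<times> d\<close> matrix; only the entries \<open>A i j\<close> and \<open>c i\<close> with \<open>i < m\<close>,
  \<open>j < d\<close> matter.
\<close>

definition ineq_set ::
  "nat \<Rightarrow> nat \<Rightarrow> (nat \<Rightarrow> nat \<Rightarrow> int) \<Rightarrow> (nat \<Rightarrow> int) \<Rightarrow> rvec set" where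
  "ineq_set m d A c =
     {x \<in> Rspace d. \<forall>i<m. (\<Sum>j<d. of_int (A i j) * Poly_Mapping.lookup x j) \<le> of_int (c i)}"

text \<open>
  Meant for finite \<open>S\<close> only (sums over infinite sets are \<open>0\<close>). The lattice points of a polytope
  are finite in number.
\<close>

definition int_cone :: "rvec set \<Rightarrow> rvec set" where
  "int_cone S = {(\<Sum>p\<in>S. real (\<mu> p) *\<^sub>R p) | \<mu> :: rvec \<Rightarrow> nat. True}"

definition vertices :: "rvec set \<Rightarrow> rvec set" where
  "vertices Q = {v. v extreme_point_of Q}"

text \<open>
  A vector indexed by \<open>M\<close> is a total function of which only the values on \<open>M\<close> are relevant.
\<close>

definition supp :: "rvec set \<Rightarrow> (rvec \<Rightarrow> nat) \<Rightarrow> rvec set" where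
  "supp M \<mu> = {s \<in> M. \<mu> s \<noteq> 0}"

end

theory Submission
  imports Defs "HOL-Library.Multiset"
begin

text \<open>
  Two lattice points of equal parity have a lattice point as midpoint, and replacing both by two
  copies of the midpoint decreases the sum of squared norms. A representation minimal for that sum
  thus uses at most \<open>2\<^sup>d\<close> points. By Caratheodory each of them lies in the hull of \<open>0\<close> and at most
  \<open>d\<close> vertices. Among all representations using only lattice points of these at most \<open>2\<^sup>d\<close> hulls,
  take one with the least number of non-vertices and, subject to that, the least sum of squared
  norms. The midpoint argument bounds the number of non-vertices in each hull by \<open>2\<^sup>d\<close>. The
  multiplicities are bounded because some doubly exponential multiple \<open>(i + 1) p\<close> of a lattice
  point \<open>p\<close> of a hull is the sum of at most \<open>i\<close> vertices and one lattice point of the same hull, which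
  would otherwise decrease the number of non-vertices.

  To find \<open>i\<close>, let \<open>x\<close> be the barycentric coordinates of \<open>p\<close>; what is needed are natural numbers
  \<open>n\<^sub>j \<le> (i + 1) x\<^sub>j\<close> with sum \<open>i\<close>. Choose a set \<open>G\<close> of large coordinates such that all others are
  small compared with \<open>\<Prod>\<^sub>j\<^sub>\<in>\<^sub>G x\<^sub>j\<close>. Approximating each \<open>i x\<^sub>j\<close> with \<open>j \<in> G\<close> by an integer up to
  \<open>x\<^sub>j / 2\<close> costs \<open>i\<close> at most the order of \<open>1 / \<Prod>\<^sub>j\<^sub>\<in>\<^sub>G x\<^sub>j\<close>, so the other coordinates stay
  negligible. Enlarging \<open>G\<close> by one coordinate roughly squares this product, whence the bound is
  doubly exponential.
\<close>

subsection \<open>Apportionment\<close>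

text \<open>Dirichlet's pigeonhole argument with a separate precision per coordinate: the
  \<open>prod m G + 1\<close> indices \<open>a\<close> in \<open>{0..prod m G}\<close> place the
  fractional parts of \<open>a * x j\<close> in \<open>prod m G\<close> boxes with sides
  \<open>1 / m j\<close>, and the difference of two indices sharing a box serves as
  \<open>i\<close>.\<close>

lemma simultaneous_approximation:
  fixes x :: "'a \<Rightarrow> real" and m :: "'a \<Rightarrow> nat"
  assumes "finite G" and m: "\<And>j. j \<in> G \<Longrightarrow> m j \<ge> 1"
  obtains i :: nat and n :: "'a \<Rightarrow> int"
  where "1 \<le> i" "i \<le> prod m G" "\<And>j. j \<in> G \<Longrightarrow> \<bar>real i * x j - of_int (n j)\<bar> < 1 / real (m j)"
proof -
  define f where "f a = (\<lambda>j\<in>G. nat \<lfloor>real (m j) * frac (real a * x j)\<rfloor>)" for a :: nat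
  have "f ` {0..prod m G} \<subseteq> PiE G (\<lambda>j. {..<m j})"
  proof (rule image_subsetI)
    fix a :: nat
    have "nat \<lfloor>real (m j) * frac (real a * x j)\<rfloor> < m j" if "j \<in> G" for j
    proof -
      have "real (m j) * frac (real a * x j) < real (m j) * 1"
        using m[OF that] frac_lt_1[of "real a * x j"] by (intro mult_strict_left_mono) auto
      then show ?thesis
        using m[OF that] by (simp add: nat_less_iff floor_less_iff)
    qed
    then show "f a \<in> PiE G (\<lambda>j. {..<m j})"
      by (auto simp: f_def)
  qed
  then have "card (f ` {0..prod m G}) \<le> card (PiE G (\<lambda>j. {..<m j}))"
    by (intro card_mono finite_PiE) (use assms in auto)
  also have "\<dots> = prod m G"
    using assms by (simp add: card_PiE)
  finally have "card (f ` {0..prod m G}) < card {0..prod m G}"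
    by simp
  then have "\<not> inj_on f {0..prod m G}"
    by (rule pigeonhole)
  then obtain a b where ab: "a < b" "b \<le> prod m G" "f a = f b"
    by (metis (no_types, lifting) atLeastAtMost_iff inj_on_def linorder_neqE_nat)
  \<comment> \<open>With this choice the error is a difference of two fractional parts from the same
    box.\<close>
  define n where "n j = \<lfloor>real b * x j\<rfloor> - \<lfloor>real a * x j\<rfloor>" for j
  have "\<bar>real (b - a) * x j - of_int (n j)\<bar> < 1 / real (m j)" if j: "j \<in> G" for j
  proof -
    let ?u = "real (m j) * frac (real a * x j)" and ?v = "real (m j) * frac (real b * x j)"
    have "nat \<lfloor>?u\<rfloor> = nat \<lfloor>?v\<rfloor>"
      using fun_cong[OF ab(3), of j] j by (simp add: f_def)
    then have "\<lfloor>?u\<rfloor> = \<lfloor>?v\<rfloor>"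
      by (simp add: eq_nat_nat_iff frac_ge_0)
    then have "\<bar>?v - ?u\<bar> < 1"
      by linarith
    then have "real (m j) * \<bar>frac (real b * x j) - frac (real a * x j)\<bar> < 1"
      by (metis abs_mult abs_of_nat right_diff_distrib)
    moreover have "real (b - a) * x j - of_int (n j) = frac (real b * x j) - frac (real a * x j)"
      using ab(1) by (simp add: n_def frac_def of_nat_diff algebra_simps)
    ultimately have "real (m j) * \<bar>real (b - a) * x j - of_int (n j)\<bar> < 1"
      by simp
    then show ?thesis
      using m[OF j] by (simp add: pos_less_divide_eq mult.commute del: of_nat_diff)
  qed
  then show thesis
    using that[of "b - a" n] ab by auto
qed

text \<open>Rounding \<open>i * x j\<close> on \<open>G\<close> errs by at most
  \<open>x j / 2\<close> each, so by at most 1/2 in total, and the coordinates outside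
  \<open>G\<close>, at most \<open>D\<close> in number, contribute at most 1/4. Hence the integers
  \<open>sum n J\<close> and \<open>i\<close> differ by less than 1 and coincide.\<close>

lemma apportionment_of_gap:
  fixes x :: "'a \<Rightarrow> real" and m :: "'a \<Rightarrow> nat"
  assumes J: "finite J" "card J \<le> D" "G \<subseteq> J"
    and x: "\<And>j. j \<in> J \<Longrightarrow> x j \<ge> 0" "sum x J = 1"
    and m: "\<And>j. j \<in> G \<Longrightarrow> m j \<ge> 1" "\<And>j. j \<in> G \<Longrightarrow> 2 \<le> real (m j) * x j"
    and small: "\<And>j. j \<in> J - G \<Longrightarrow> 4 * real D * real (prod m G) * x j < 1"
  obtains i :: nat and n :: "'a \<Rightarrow> nat"
  where "1 \<le> i" "i \<le> prod m G" "\<And>j. j \<in> J \<Longrightarrow> real (n j) \<le> (real i + 1) * x j" "sum n J = i"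
proof -
  have fin: "finite G" "finite (J - G)"
    using J by (auto intro: finite_subset)
  obtain i and n :: "'a \<Rightarrow> int" where i: "1 \<le> i" "i \<le> prod m G"
    and n: "\<And>j. j \<in> G \<Longrightarrow> \<bar>real i * x j - of_int (n j)\<bar> < 1 / real (m j)"
    by (rule simultaneous_approximation[OF fin(1) m(1), where x = x], assumption, rule that)
  have half: "1 / real (m j) \<le> x j / 2" if "j \<in> G" for j
    using m[OF that] by (simp add: field_simps)
  have near: "\<bar>real i * x j - of_int (n j)\<bar> < x j / 2" if "j \<in> G" for j
    using n[OF that] half[OF that] by linarith
  have pos: "n j \<ge> 0" if "j \<in> G" for j
  proof -
    have "x j \<ge> 0"
      using x(1) J(3) that by auto
    moreover have "real i * x j \<ge> 1 * x j"
      using i(1) \<open>x j \<ge> 0\<close> by (intro mult_right_mono) auto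
    ultimately have "of_int (n j) > (- 1 :: real)"
      using near[OF that] by linarith
    then show ?thesis
      by linarith
  qed
  \<comment> \<open>Coordinates outside \<open>G\<close> are rounded down to 0; on \<open>G\<close>
    the conversion to \<open>nat\<close> is exact by \<open>pos\<close>.\<close>
  define n' where "n' j = (if j \<in> G then nat (n j) else 0)" for j
  have le: "real (n' j) \<le> (real i + 1) * x j" if "j \<in> J" for j
  proof (cases "j \<in> G")
    case True
    have "of_int (n j) \<le> real i * x j + x j"
      using near[OF True] x(1)[OF that] by linarith
    then show ?thesis
      using True pos[OF True] by (simp add: n'_def distrib_right)
  next
    case False
    then show ?thesis
      using x(1)[OF that] by (simp add: n'_def)
  qed
  let ?a = "\<Sum>j\<in>G. real i * x j - of_int (n j)" and ?b = "\<Sum>j\<in>J - G. real i * x j"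
  have "real (sum n' J) = (\<Sum>j\<in>G. of_int (n j))"
    using J pos by (simp add: n'_def sum.If_cases Int_absorb1)
  moreover have "real i = (\<Sum>j\<in>G. real i * x j) + ?b"
    using x(2) J(1,3) by (metis mult.right_neutral sum.subset_diff sum_distrib_left add.commute)
  ultimately have eq: "real i - real (sum n' J) = ?a + ?b"
    by (simp add: sum_subtractf)
  have "\<bar>?a\<bar> \<le> (\<Sum>j\<in>G. x j / 2)"
    by (rule order_trans[OF sum_abs sum_mono]) (use near in force)
  also have "\<dots> \<le> 1 / 2"
    using sum_mono2[OF J(1,3), of x] x by (simp flip: sum_divide_distrib)
  finally have a: "\<bar>?a\<bar> \<le> 1 / 2" .
  have b0: "?b \<ge> 0"
    using x(1) by (intro sum_nonneg) auto
  have "real i * x j \<le> 1 / (4 * real D)" if "j \<in> J - G" for j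
  proof -
    have "D > 0"
      using that J(1,2) by (metis DiffD1 card_gt_0_iff empty_iff not_gr_zero less_le_trans)
    have "real i * x j \<le> real (prod m G) * x j"
      using i(2) x(1) that by (intro mult_right_mono) (auto simp del: of_nat_prod)
    then have "4 * real D * (real i * x j) \<le> 4 * real D * (real (prod m G) * x j)"
      by (intro mult_left_mono) auto
    also have "\<dots> < 1"
      using small[OF that] by (simp only: mult.assoc)
    finally show ?thesis
      using \<open>D > 0\<close> by (simp add: field_simps)
  qed
  then have "?b \<le> real (card (J - G)) * (1 / (4 * real D))"
    by (intro order_trans[OF sum_bounded_above]) auto
  also have "\<dots> \<le> real D * (1 / (4 * real D))"
    using card_mono[OF J(1), of "J - G"] J(2) by (intro mult_right_mono) auto
  also have "\<dots> \<le> 1 / 4"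
    by simp
  finally have "\<bar>real i - real (sum n' J)\<bar> < 1"
    using eq a b0 by linarith
  then have "sum n' J = i"
    by linarith
  then show thesis
    using that[of i n'] i le by blast
qed

text \<open>If every \<open>i\<close> failed, then by \<open>apportionment_of_gap\<close> no
  admissible set \<open>G\<close> would be separated from the rest by a gap, so \<open>G\<close>
  could be enlarged beyond \<open>card J\<close> elements.\<close>

lemma apportionment:
  fixes x :: "'a \<Rightarrow> real"
  assumes J: "finite J" "card J \<le> D" and x: "\<And>j. j \<in> J \<Longrightarrow> x j \<ge> 0" "sum x J = 1"
  obtains i :: nat and n :: "'a \<Rightarrow> nat"
  where "1 \<le> i" "i + 1 \<le> (8 * D) ^ 2 ^ D"
    "\<And>j. j \<in> J \<Longrightarrow> real (n j) \<le> (real i + 1) * x j" "sum n J = i"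
proof -
  define good where "good \<longleftrightarrow> (\<exists>i n. 1 \<le> i \<and> i + 1 \<le> (8 * D) ^ 2 ^ D \<and>
    (\<forall>j\<in>J. real (n j) \<le> (real i + 1) * x j) \<and> sum n J = i)"
  have "J \<noteq> {}"
    using x(2) by auto
  then have D: "D \<ge> 1"
    using J by (metis card_gt_0_iff less_le_trans less_one linorder_not_less)
  have "good" if "\<not> good"
  proof -
    \<comment> \<open>The factor \<open>8 * D\<close> is kept in the invariant because
      \<open>8 * D * prod m G\<close> is exactly the quantity that each enlargement squares.\<close>
    have ex: "\<exists>G (m :: 'a \<Rightarrow> nat). G \<subseteq> J \<and> card G = t \<and> 8 * D * prod m G \<le> (8 * D) ^ 2 ^ t \<and>
        (\<forall>j\<in>G. m j \<ge> 1 \<and> 2 \<le> real (m j) * x j)" if "t \<le> Suc (card J)" for t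
      using that
    proof (induction t)
      case 0
      show ?case
        by (rule exI[of _ "{}"]) simp
    next
      case (Suc t)
      then obtain G and m :: "'a \<Rightarrow> nat" where G: "G \<subseteq> J" "card G = t"
        and w: "8 * D * prod m G \<le> (8 * D) ^ 2 ^ t"
        and m: "\<And>j. j \<in> G \<Longrightarrow> m j \<ge> 1" "\<And>j. j \<in> G \<Longrightarrow> 2 \<le> real (m j) * x j"
        by auto
      have finG: "finite G"
        using G(1) J(1) by (rule finite_subset)
      have w1: "prod m G \<ge> 1"
        using m(1) prod_ge_1 by (metis (mono_tags))
      have "\<exists>j\<in>J - G. 4 * real D * real (prod m G) * x j \<ge> 1"
      proof (rule ccontr)
        assume neg: "\<not> ?thesis"
        obtain i and n :: "'a \<Rightarrow> nat" where i: "1 \<le> i" "i \<le> prod m G"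
          and n: "\<And>j. j \<in> J \<Longrightarrow> real (n j) \<le> (real i + 1) * x j" "sum n J = i"
          by (rule apportionment_of_gap[OF J G(1) x m]) (use neg in \<open>force+\<close>)
        have "i + 1 \<le> 8 * D * prod m G"
          using i(2) w1 mult_le_mono1[of 2 "8 * D" "prod m G"] D by linarith
        also have "\<dots> \<le> (8 * D) ^ 2 ^ D"
          using w D Suc.prems J(2) G
          by (intro order_trans[OF w] power_increasing) (auto intro: le_trans[OF _ J(2)] card_mono[OF J(1)])
        finally have good
          unfolding good_def using i(1) n by blast
        then show False
          using \<open>\<not> good\<close> by blast
      qed
      then obtain j where j: "j \<in> J - G" "4 * real D * real (prod m G) * x j \<ge> 1"
        by blast
      \<comment> \<open>The missing gap says \<open>x j \<ge> 1 / (4 * D * prod m G)\<close>, so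
        this precision satisfies \<open>2 \<le> m' j * x j\<close>.\<close>
      define m' where "m' = m(j := 8 * D * prod m G)"
      have eq: "prod m' G = prod m G"
        using j(1) by (intro prod.cong) (auto simp: m'_def)
      have "prod m' (insert j G) = 8 * D * prod m G * prod m G"
        using finG j(1) eq by (simp add: m'_def)
      then have "8 * D * prod m' (insert j G) = (8 * D * prod m G)\<^sup>2"
        by (simp add: power2_eq_square)
      also have "\<dots> \<le> ((8 * D) ^ 2 ^ t)\<^sup>2"
        using w by (rule power_mono) simp
      also have "\<dots> = (8 * D) ^ 2 ^ Suc t"
        by (simp only: power_mult[symmetric] power_Suc2)
      finally have "8 * D * prod m' (insert j G) \<le> (8 * D) ^ 2 ^ Suc t" .
      moreover have "insert j G \<subseteq> J" "card (insert j G) = Suc t"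
        using j(1) G finG by auto
      moreover have "\<forall>k\<in>insert j G. m' k \<ge> 1 \<and> 2 \<le> real (m' k) * x k"
        using j m w1 D by (auto simp: m'_def mult_ac simp del: of_nat_prod)
      ultimately show ?case
        by blast
    qed
    from ex[of "Suc (card J)"] obtain G where "G \<subseteq> J" "card G = Suc (card J)"
      by blast
    then show ?thesis
      using card_mono[OF J(1), of G] by simp
  qed
  then show thesis
    unfolding good_def using that by blast
qed

subsection \<open>Convex hulls of finite sets\<close>

text \<open>The library's Krein--Milman theorem requires a Euclidean space, which \<open>rvec\<close> is not.\<close>

lemma Krein_Milman_finite:
  fixes S :: "'a::real_normed_vector set"
  assumes "finite S"
  shows "convex hull S = convex hull {v. v extreme_point_of (convex hull S)}"
proof -
  \<comment> \<open>A generating subset of least size: none of its points lies in the hull of the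
    others, which makes each of them extreme.\<close>
  obtain T where T: "T \<subseteq> S" "convex hull T = convex hull S"
    and min: "\<And>T'. T' \<subseteq> S \<Longrightarrow> convex hull T' = convex hull S \<Longrightarrow> card T \<le> card T'"
  proof -
    let ?P = "\<lambda>T. T \<subseteq> S \<and> convex hull T = convex hull S"
    have "?P S"
      by simp
    then have "\<exists>T. ?P T \<and> (\<forall>T'. ?P T' \<longrightarrow> card T \<le> card T')"
      by (rule ex_has_least_nat)
    then obtain T where "?P T" "\<forall>T'. ?P T' \<longrightarrow> card T \<le> card T'"
      by (elim exE conjE) (rule that, simp_all)
    then show thesis
      by (intro that[of T]) simp_all
  qed
  have finT: "finite T"
    using T(1) assms by (rule finite_subset)
  have "t extreme_point_of (convex hull S)" if t: "t \<in> T" for t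
  proof -
    have "t \<notin> convex hull (T - {t})"
    proof
      assume "t \<in> convex hull (T - {t})"
      then have "convex hull (insert t (T - {t})) = convex hull (T - {t})"
        by (simp add: hull_redundant_eq)
      then show False
        using min[of "T - {t}"] t T card_Diff1_less[OF finT t] by (auto simp: insert_absorb)
    qed
    moreover have "finite (T - {t})"
      using finT by simp
    ultimately have "t extreme_point_of (convex hull (insert t (T - {t})))"
      by (intro extreme_point_of_convex_hull_insert)
    then show ?thesis
      using t T(2) by (simp add: insert_absorb)
  qed
  then have "convex hull T \<subseteq> convex hull {v. v extreme_point_of (convex hull S)}"
    by (intro hull_mono) auto
  moreover have "convex hull {v. v extreme_point_of (convex hull S)} \<subseteq> convex hull S"
    by (intro hull_mono) (auto dest: extreme_point_of_convex_hull)
  ultimately show ?thesis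
    using T(2) by auto
qed

section \<open>Coordinates, dimension and Caratheodory's theorem in \<open>Rspace d\<close>\<close>

lemma lookup_scaleR: "Poly_Mapping.lookup (r *\<^sub>R x) j = r *\<^sub>R Poly_Mapping.lookup x j"
proof (cases "r = 0")
  case False
  then have "finite {i. r *\<^sub>R Poly_Mapping.lookup x i \<noteq> 0}"
    by simp
  then show ?thesis
    by (simp add: scaleR_poly_mapping_def Abs_poly_mapping_inverse)
qed simp

lemma linear_lookup: "linear (\<lambda>x :: rvec. Poly_Mapping.lookup x j)"
  by (rule linearI) (simp_all add: lookup_add lookup_scaleR)

lemma lookup_sum: "Poly_Mapping.lookup (sum f S) j = (\<Sum>x\<in>S. Poly_Mapping.lookup (f x) j)" for f :: "'a \<Rightarrow> rvec"
  by (rule linear_sum[OF linear_lookup])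

lemma subspace_Rspace: "subspace (Rspace d)"
proof -
  have "Rspace d = {x. \<forall>j. j \<notin> {..<d} \<longrightarrow> Poly_Mapping.lookup x j = 0}"
    by (auto simp: Rspace_def in_keys_iff)
  then show ?thesis
    by (auto simp: subspace_def lookup_add lookup_scaleR)
qed

text \<open>The \<open>d\<close> unit vectors span \<open>Rspace d\<close>, and an independent set
  is no larger than a finite spanning set.\<close>

lemma card_independent_Rspace:
  assumes "independent B" "B \<subseteq> Rspace d"
  shows "finite B \<and> card B \<le> d"
proof -
  let ?e = "\<lambda>j. Poly_Mapping.single j (1::real)"
  have "x \<in> span (?e ` {..<d})" if "x \<in> Rspace d" for x
  proof -
    have "x = (\<Sum>j<d. Poly_Mapping.lookup x j *\<^sub>R ?e j)"
    proof (rule poly_mapping_eqI)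
      fix k
      have "(\<Sum>j<d. Poly_Mapping.lookup x j * (1 when j = k)) = (if k < d then Poly_Mapping.lookup x k else 0)"
        by (simp add: when_def if_distrib[of "(*) _"] sum.delta cong: if_cong)
      also have "\<dots> = Poly_Mapping.lookup x k"
        using that by (auto simp: Rspace_def in_keys_iff)
      finally show "Poly_Mapping.lookup x k = Poly_Mapping.lookup (\<Sum>j<d. Poly_Mapping.lookup x j *\<^sub>R ?e j) k"
        by (simp add: lookup_sum lookup_scaleR lookup_single)
    qed
    then show ?thesis
      by (metis (no_types, lifting) span_sum span_scale span_base imageI)
  qed
  then have "finite B \<and> card B \<le> card (?e ` {..<d})"
    using assms by (intro independent_span_bound) auto
  then show ?thesis
    using card_image_le[of "{..<d}" ?e] by auto
qed

text \<open>Among all sets of vertices representing \<open>p\<close>, one of minimal size is linearly independent.\<close>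

lemma Caratheodory_origin:
  assumes "finite V" "V \<subseteq> Rspace d" "p \<in> convex hull (insert 0 V)"
  obtains B where "B \<subseteq> V" "card B \<le> d" "p \<in> convex hull (insert 0 B)"
proof -
  \<comment> \<open>The weight of the origin is left implicit as \<open>1 - sum u B\<close>. Hence
    linear rather than affine independence is the relevant notion, which gives \<open>d\<close>
    instead of \<open>d + 1\<close> points.\<close>
  define Q where "Q B u \<longleftrightarrow> B \<subseteq> V \<and> (\<forall>v\<in>B. u v \<ge> 0) \<and> sum u B \<le> 1 \<and> (\<Sum>v\<in>B. u v *\<^sub>R v) = p"
    for B and u :: "rvec \<Rightarrow> real"
  obtain u where u: "\<forall>v\<in>insert 0 V. u v \<ge> 0" "sum u (insert 0 V) = 1" "(\<Sum>v\<in>insert 0 V. u v *\<^sub>R v) = p"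
    using assms by (auto simp: convex_hull_finite)
  have "sum u V \<le> sum u (insert 0 V)"
    using assms(1) u(1) by (intro sum_mono2) auto
  moreover have "(\<Sum>v\<in>insert 0 V. u v *\<^sub>R v) = (\<Sum>v\<in>V. u v *\<^sub>R v)"
    using assms(1) by (intro sum.mono_neutral_right) auto
  ultimately have "\<exists>u. Q V u"
    unfolding Q_def using u by (intro exI[of _ u]) auto
  then obtain B where B: "\<exists>u. Q B u" and min: "\<And>B'. \<exists>u. Q B' u \<Longrightarrow> card B \<le> card B'"
    using ex_has_least_nat[of "\<lambda>B. \<exists>u. Q B u" V card] by blast
  then obtain u where "Q B u"
    by blast
  then have Q: "B \<subseteq> V" "\<And>v. v \<in> B \<Longrightarrow> u v \<ge> 0" "sum u B \<le> 1" "(\<Sum>v\<in>B. u v *\<^sub>R v) = p"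
    by (auto simp: Q_def)
  have finB: "finite B"
    using Q(1) assms(1) finite_subset by auto
  have "independent B"
  proof
    assume "dependent B"
    then obtain a0 where "\<exists>v\<in>B. a0 v \<noteq> 0" "(\<Sum>v\<in>B. a0 v *\<^sub>R v) = 0"
      by (auto simp: dependent_finite[OF finB])
    \<comment> \<open>The sign is chosen so that subtracting a nonnegative multiple of
      \<open>a\<close> keeps the total weight at most 1.\<close>
    then obtain a where a: "\<exists>v\<in>B. a v \<noteq> 0" "(\<Sum>v\<in>B. a v *\<^sub>R v) = 0" "sum a B \<ge> 0"
    proof (cases "sum a0 B \<ge> 0")
      case False
      then show ?thesis
        using \<open>\<exists>v\<in>B. a0 v \<noteq> 0\<close> \<open>(\<Sum>v\<in>B. a0 v *\<^sub>R v) = 0\<close>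
        by (intro that[of "\<lambda>v. - a0 v"]) (auto simp: sum_negf)
    qed auto
    define R where "R = {v \<in> B. a v > 0}"
    have "R \<noteq> {}"
    proof
      assume "R = {}"
      then have neg: "\<And>v. v \<in> B \<Longrightarrow> a v \<le> 0"
        by (force simp: R_def)
      then have "sum a B = 0"
        using a(3) sum_nonpos[of B a] by force
      then have "\<forall>v\<in>B. a v = 0"
        using neg sum_nonneg_eq_0_iff[OF finB, of "\<lambda>v. - a v"] by (auto simp: sum_negf)
      then show False
        using a(1) by blast
    qed
    have finR: "finite R"
      using finB by (simp add: R_def)
    \<comment> \<open>The largest multiple of \<open>a\<close> that can be subtracted with all
      weights staying nonnegative; the weight of a minimiser \<open>w\<close> drops to 0, so
      \<open>w\<close> can be left out.\<close>
    define t where "t = Min ((\<lambda>v. u v / a v) ` R)"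
    have "t \<in> (\<lambda>v. u v / a v) ` R"
      unfolding t_def using finR \<open>R \<noteq> {}\<close> by (intro Min_in) auto
    then obtain w where w: "w \<in> R" "t = u w / a w"
      by auto
    have tle: "t \<le> u v / a v" if "v \<in> R" for v
      unfolding t_def using finR that by (intro Min_le) auto
    have t0: "t \<ge> 0"
      using w Q(2) by (auto simp: R_def)
    define u' where "u' v = u v - t * a v" for v
    have u'w: "u' w = 0" and wB: "w \<in> B"
      using w by (auto simp: u'_def R_def)
    have "u' v \<ge> 0" if v: "v \<in> B" for v
    proof (cases "a v > 0")
      case True
      then show ?thesis
        using tle[of v] v by (simp add: u'_def R_def field_simps)
    next
      case False
      then show ?thesis
        using t0 Q(2)[OF v] mult_nonneg_nonpos[of t "a v"] by (simp add: u'_def)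
    qed
    moreover have "sum u' B \<le> 1"
      using Q(3) mult_nonneg_nonneg[OF t0 a(3)]
      by (simp add: u'_def sum_subtractf flip: sum_distrib_left del: mult_nonneg_nonneg)
    moreover have "(\<Sum>v\<in>B. u' v *\<^sub>R v) = p"
    proof -
      have "(\<Sum>v\<in>B. u' v *\<^sub>R v) = (\<Sum>v\<in>B. u v *\<^sub>R v) - t *\<^sub>R (\<Sum>v\<in>B. a v *\<^sub>R v)"
        by (simp add: u'_def scaleR_diff_left sum_subtractf scaleR_sum_right)
      then show ?thesis
        using a(2) Q(4) by simp
    qed
    moreover have "sum u' (B - {w}) = sum u' B" "(\<Sum>v\<in>B - {w}. u' v *\<^sub>R v) = (\<Sum>v\<in>B. u' v *\<^sub>R v)"
      using finB wB u'w by (simp_all add: sum_diff1)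
    ultimately have "Q (B - {w}) u'"
      using Q(1) by (auto simp: Q_def)
    then have "card B \<le> card (B - {w})"
      using min by blast
    then show False
      using card_Diff1_less[OF finB wB] by simp
  qed
  then have "card B \<le> d"
    using card_independent_Rspace[of B d] Q(1) assms(2) by auto
  moreover have "p \<in> convex hull (insert 0 B)"
  proof -
    \<comment> \<open>The missing mass goes to the origin, on top of any weight it has as an element
      of \<open>B\<close>.\<close>
    let ?u = "u(0 := (if 0 \<in> B then u 0 else 0) + (1 - sum u B))"
    have B0: "sum ?u (B - {0}) = sum u (B - {0})" "(\<Sum>v\<in>B - {0}. ?u v *\<^sub>R v) = (\<Sum>v\<in>B - {0}. u v *\<^sub>R v)"
      by (auto intro: sum.cong)
    have "sum ?u (insert 0 B) = 1"
      using finB by (subst sum.insert_remove) (auto simp: B0 sum_diff1)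
    moreover have "(\<Sum>v\<in>insert 0 B. ?u v *\<^sub>R v) = p"
      using finB Q(4) by (subst sum.insert_remove) (auto simp: B0 sum_diff1)
    moreover have "\<forall>v\<in>insert 0 B. ?u v \<ge> 0"
      using Q(2,3) by auto
    ultimately show ?thesis
      unfolding convex_hull_finite[OF finite.insertI[OF finB]] mem_Collect_eq
      by (intro exI[of _ ?u] conjI)
  qed
  ultimately show thesis
    using that[of B] Q(1) by auto
qed

subsection \<open>Lattice points and midpoints\<close>

lemma Zlattice_add: "x \<in> Zlattice d \<Longrightarrow> y \<in> Zlattice d \<Longrightarrow> x + y \<in> Zlattice d"
  using subspace_add[OF subspace_Rspace] by (auto simp: Zlattice_def lookup_add)

lemma Zlattice_diff: "x \<in> Zlattice d \<Longrightarrow> y \<in> Zlattice d \<Longrightarrow> x - y \<in> Zlattice d"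
  using subspace_diff[OF subspace_Rspace] by (auto simp: Zlattice_def lookup_minus)

lemma Zlattice_scaleR_of_nat: "x \<in> Zlattice d \<Longrightarrow> real n *\<^sub>R x \<in> Zlattice d"
  using subspace_scale[OF subspace_Rspace] by (auto simp: Zlattice_def lookup_scaleR)

lemma zero_in_Zlattice: "0 \<in> Zlattice d"
  using subspace_0[OF subspace_Rspace] by (auto simp: Zlattice_def)

lemma Zlattice_sum: "(\<And>x. x \<in> S \<Longrightarrow> f x \<in> Zlattice d) \<Longrightarrow> sum f S \<in> Zlattice d"
  by (induction S rule: infinite_finite_induct) (auto intro: Zlattice_add zero_in_Zlattice)

lemma Zlattice_Ints: "x \<in> Zlattice d \<Longrightarrow> j < d \<Longrightarrow> Poly_Mapping.lookup x j \<in> \<int>"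
  by (simp add: Zlattice_def)

lemma lookup_Zlattice_eq_0: "x \<in> Zlattice d \<Longrightarrow> \<not> j < d \<Longrightarrow> Poly_Mapping.lookup x j = 0"
  by (auto simp: Zlattice_def Rspace_def in_keys_iff)

lemma Zlattice_eqI:
  assumes "x \<in> Zlattice d" "y \<in> Zlattice d"
    and "\<And>j. j < d \<Longrightarrow> Poly_Mapping.lookup x j = Poly_Mapping.lookup y j"
  shows "x = y"
proof (rule poly_mapping_eqI)
  fix j
  show "Poly_Mapping.lookup x j = Poly_Mapping.lookup y j"
    using assms by (cases "j < d") (simp_all add: lookup_Zlattice_eq_0)
qed

text \<open>Coordinates are bounded on the hull of a finite set because slabs are convex, and a
  lattice point is determined by its \<open>d\<close> integral coordinates; so the floors map the
  set injectively into a finite box.\<close>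

lemma finite_lattice_points:
  assumes "polytope P"
  shows "finite (P \<inter> Zlattice d)"
proof -
  obtain T where T: "finite T" "P = convex hull T"
    using assms by (auto simp: polytope_def)
  define K where "K = (\<Sum>x\<in>T. \<Sum>j<d. \<bar>Poly_Mapping.lookup x j\<bar>)"
  have K: "\<bar>Poly_Mapping.lookup x j\<bar> \<le> K" if "x \<in> P" "j < d" for x j
  proof -
    have "\<bar>Poly_Mapping.lookup y j\<bar> \<le> K" if "y \<in> T" for y
    proof -
      have "\<bar>Poly_Mapping.lookup y j\<bar> \<le> (\<Sum>j<d. \<bar>Poly_Mapping.lookup y j\<bar>)"
        using \<open>j < d\<close> by (intro member_le_sum) auto
      also have "\<dots> \<le> K"
        unfolding K_def using T(1) that by (intro member_le_sum) (auto intro: sum_nonneg)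
      finally show ?thesis .
    qed
    then have "T \<subseteq> (\<lambda>x. Poly_Mapping.lookup x j) -` {-K..K}"
      by (auto simp: abs_le_iff minus_le_iff)
    then have "P \<subseteq> (\<lambda>x. Poly_Mapping.lookup x j) -` {-K..K}"
      unfolding T(2) by (intro hull_minimal convex_linear_vimage linear_lookup convex_real_interval)
    then show ?thesis
      using subsetD that(1) by fastforce
  qed
  let ?f = "\<lambda>x. \<lambda>j\<in>{..<d}. \<lfloor>Poly_Mapping.lookup x j\<rfloor>"
  have "inj_on ?f (P \<inter> Zlattice d)"
  proof (rule inj_onI)
    fix x y
    assume x: "x \<in> P \<inter> Zlattice d" and y: "y \<in> P \<inter> Zlattice d" and eq: "?f x = ?f y"
    show "x = y"
    proof (rule Zlattice_eqI[of _ d])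
      fix j
      assume "j < d"
      then have "\<lfloor>Poly_Mapping.lookup x j\<rfloor> = \<lfloor>Poly_Mapping.lookup y j\<rfloor>"
        using fun_cong[OF eq, of j] by simp
      moreover have "Poly_Mapping.lookup x j \<in> \<int>" "Poly_Mapping.lookup y j \<in> \<int>"
        using x y \<open>j < d\<close> by (auto simp: Zlattice_def)
      ultimately show "Poly_Mapping.lookup x j = Poly_Mapping.lookup y j"
        by (metis floor_of_int Ints_cases)
    qed (use x y in auto)
  qed
  moreover have "?f ` (P \<inter> Zlattice d) \<subseteq> PiE {..<d} (\<lambda>_. {- \<lceil>K\<rceil>..\<lceil>K\<rceil>})"
  proof (intro image_subsetI restrict_PiE_iff[THEN iffD2] ballI)
    fix x j
    assume "x \<in> P \<inter> Zlattice d" "j \<in> {..<d}"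
    then have "Poly_Mapping.lookup x j \<in> \<int>" "\<bar>Poly_Mapping.lookup x j\<bar> \<le> K"
      using K by (auto simp: Zlattice_def)
    then show "\<lfloor>Poly_Mapping.lookup x j\<rfloor> \<in> {- \<lceil>K\<rceil>..\<lceil>K\<rceil>}"
      by (auto elim!: Ints_cases) linarith+
  qed
  ultimately show ?thesis
    by (rule inj_on_finite) (auto intro: finite_PiE)
qed

text \<open>Encodes the class of a lattice point modulo 2 as a subset of \<open>{..<d}\<close>, so
  that there are at most \<open>2 ^ d\<close> classes.\<close>

definition parity :: "nat \<Rightarrow> rvec \<Rightarrow> nat set" where
  "parity d x = {j. j < d \<and> odd \<lfloor>Poly_Mapping.lookup x j\<rfloor>}"

text \<open>Valued in \<open>nat\<close> so that minimisers exist by well-ordering; by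
  \<open>real_sqnorm\<close> the rounding is exact on lattice points.\<close>

definition sqnorm :: "nat \<Rightarrow> rvec \<Rightarrow> nat" where
  "sqnorm d x = nat \<lfloor>\<Sum>j<d. (Poly_Mapping.lookup x j)\<^sup>2\<rfloor>"

lemma real_sqnorm:
  assumes "x \<in> Zlattice d"
  shows "real (sqnorm d x) = (\<Sum>j<d. (Poly_Mapping.lookup x j)\<^sup>2)"
proof -
  have "(\<Sum>j<d. (Poly_Mapping.lookup x j)\<^sup>2) \<in> \<int>"
    using assms by (intro Ints_sum) (auto simp: Zlattice_def)
  moreover have "(\<Sum>j<d. (Poly_Mapping.lookup x j)\<^sup>2) \<ge> 0"
    by (intro sum_nonneg) auto
  ultimately show ?thesis
    by (auto simp: sqnorm_def elim: Ints_cases)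
qed

lemma midpoint_in_Zlattice:
  assumes x: "x \<in> Zlattice d" and y: "y \<in> Zlattice d" and par: "parity d x = parity d y"
  shows "midpoint x y \<in> Zlattice d"
proof -
  have "Poly_Mapping.lookup (midpoint x y) j \<in> \<int>" if j: "j < d" for j
  proof -
    obtain a b where ab: "Poly_Mapping.lookup x j = of_int a" "Poly_Mapping.lookup y j = of_int b"
      using Zlattice_Ints[OF x j] Zlattice_Ints[OF y j] by (elim Ints_cases) (rule that)
    have "j \<in> parity d x \<longleftrightarrow> j \<in> parity d y"
      using par by simp
    then have "even (a + b)"
      using j ab by (simp add: parity_def)
    then obtain c where "a + b = 2 * c"
      by (rule evenE)
    then have "of_int a + of_int b = (2 * of_int c :: real)"
      by (metis of_int_add of_int_mult of_int_numeral)
    then have "Poly_Mapping.lookup (midpoint x y) j = of_int c"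
      using ab by (simp add: midpoint_def lookup_scaleR lookup_add)
    then show ?thesis
      by simp
  qed
  moreover have "midpoint x y \<in> Rspace d"
    using x y subspace_scale[OF subspace_Rspace] subspace_add[OF subspace_Rspace]
    by (auto simp: midpoint_def Zlattice_def)
  ultimately show ?thesis
    by (simp add: Zlattice_def)
qed

text \<open>By the parallelogram identity the loss is half the squared distance of \<open>x\<close>
  and \<open>y\<close>. Equal parity makes the midpoint a lattice point, where \<open>sqnorm\<close>
  is exact.\<close>

lemma sqnorm_midpoint_less:
  assumes x: "x \<in> Zlattice d" and y: "y \<in> Zlattice d"
    and par: "parity d x = parity d y" and "x \<noteq> y"
  shows "2 * sqnorm d (midpoint x y) < sqnorm d x + sqnorm d y"
proof -
  let ?l = Poly_Mapping.lookup
  obtain j where j: "j < d" "?l x j \<noteq> ?l y j"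
    using Zlattice_eqI[OF x y] \<open>x \<noteq> y\<close> by blast
  have eq: "(?l x k)\<^sup>2 + (?l y k)\<^sup>2 = 2 * (?l (midpoint x y) k)\<^sup>2 + (?l x k - ?l y k)\<^sup>2 / 2" for k
    by (simp add: midpoint_def lookup_scaleR lookup_add power2_eq_square field_simps)
  have "0 < (\<Sum>k<d. (?l x k - ?l y k)\<^sup>2 / 2)"
    using j by (intro sum_pos2[of _ j]) auto
  moreover have "real (sqnorm d x + sqnorm d y) = real (2 * sqnorm d (midpoint x y)) + (\<Sum>k<d. (?l x k - ?l y k)\<^sup>2 / 2)"
    by (simp add: real_sqnorm x y midpoint_in_Zlattice[OF x y par] sum_distrib_left flip: sum.distrib eq)
  ultimately show ?thesis
    by linarith
qed

text \<open>The move behind both minimality arguments. The remainder \<open>Z\<close> is exposed so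
  that membership and counts can be compared before and after.\<close>

lemma midpoint_exchange:
  fixes X :: "rvec multiset"
  assumes "x \<in># X" "y \<in># X" "x \<noteq> y" "x \<in> Zlattice d" "y \<in> Zlattice d" "parity d x = parity d y"
  obtains Z where "X = Z + {#x, y#}"
    "sum_mset (Z + {#midpoint x y, midpoint x y#}) = sum_mset X"
    "(\<Sum>z\<in>#Z + {#midpoint x y, midpoint x y#}. sqnorm d z) < (\<Sum>z\<in>#X. sqnorm d z)"
proof -
  obtain Z where Z: "X = Z + {#x, y#}"
    using assms(1-3) by (metis add_mset_add_single add_mset_commute insert_noteq_member
        multi_member_split union_mset_add_mset_right empty_neutral(2))
  have "sum_mset (Z + {#midpoint x y, midpoint x y#}) = sum_mset Z + (midpoint x y + midpoint x y)"
    by (simp add: add_ac)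
  also have "\<dots> = sum_mset X"
    unfolding midpoint_plus_self Z by (simp add: add_ac)
  finally have "sum_mset (Z + {#midpoint x y, midpoint x y#}) = sum_mset X" .
  then show thesis
    using that[OF Z] sqnorm_midpoint_less[OF assms(4-6,3)] by (simp add: Z)
qed

lemma card_inj_on_parity:
  assumes "inj_on (parity d) S"
  shows "card S \<le> 2 ^ d"
proof -
  have "card S \<le> card (Pow {..<d})"
    using assms by (rule card_inj_on_le) (auto simp: parity_def)
  then show ?thesis
    by (simp add: card_Pow)
qed

text \<open>The bound of Eisenbrand and Shmonin on the support of integer conic combinations.\<close>

lemma small_support:
  fixes X :: "rvec multiset"
  assumes "convex S" "set_mset X \<subseteq> S \<inter> Zlattice d"
  obtains Y where "sum_mset Y = sum_mset X" "set_mset Y \<subseteq> S \<inter> Zlattice d" "card (set_mset Y) \<le> 2 ^ d"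
proof -
  define P where "P Y \<longleftrightarrow> sum_mset Y = sum_mset X \<and> set_mset Y \<subseteq> S \<inter> Zlattice d" for Y
  have "P X"
    using assms by (simp add: P_def)
  then have "\<exists>Y. P Y \<and> (\<forall>Y'. P Y' \<longrightarrow> (\<Sum>z\<in>#Y. sqnorm d z) \<le> (\<Sum>z\<in>#Y'. sqnorm d z))"
    by (rule ex_has_least_nat)
  then obtain Y where Y: "P Y" and min: "\<And>Y'. P Y' \<Longrightarrow> (\<Sum>z\<in>#Y. sqnorm d z) \<le> (\<Sum>z\<in>#Y'. sqnorm d z)"
    by metis
  \<comment> \<open>Two points of one parity class could be exchanged for their midpoint, which
    stays in \<open>S\<close> by convexity, against minimality.\<close>
  have "inj_on (parity d) (set_mset Y)"
  proof (rule inj_onI, rule ccontr)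
    fix x y
    assume xy: "x \<in># Y" "y \<in># Y" "parity d x = parity d y" "x \<noteq> y"
    then have mem: "x \<in> S \<inter> Zlattice d" "y \<in> S \<inter> Zlattice d"
      using Y by (auto simp: P_def)
    obtain Z where Z: "Y = Z + {#x, y#}"
      "sum_mset (Z + {#midpoint x y, midpoint x y#}) = sum_mset Y"
      "(\<Sum>z\<in>#Z + {#midpoint x y, midpoint x y#}. sqnorm d z) < (\<Sum>z\<in>#Y. sqnorm d z)"
      by (rule midpoint_exchange[of x Y y d]) (use xy mem in auto)
    have "midpoint x y \<in> S"
      using convexD_alt[OF assms(1), of x y "1/2"] mem by (simp add: midpoint_def scaleR_add_right)
    moreover have "midpoint x y \<in> Zlattice d"
      using mem xy by (intro midpoint_in_Zlattice) auto
    ultimately have "P (Z + {#midpoint x y, midpoint x y#})"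
      using Y Z(1,2) by (auto simp: P_def)
    then show False
      using min Z(3) by (meson not_less)
  qed
  then show thesis
    using that Y card_inj_on_parity by (auto simp: P_def)
qed

subsection \<open>Representations with few non-vertices\<close>

text \<open>The coefficients \<open>(i + 1) * u v\<close> are split into the integers
  \<open>n v\<close> from \<open>apportionment\<close> and nonnegative remainders with sum
  \<open>(i + 1) - i = 1\<close>. The remainders form a convex combination \<open>q\<close>, a
  lattice point as a difference of lattice points. The hull has up to \<open>d + 1\<close>
  generators, whence \<open>d + 1\<close> in the bound.\<close>

lemma multiple_in_simplex:
  assumes B: "finite B" "card B \<le> d" "B \<subseteq> Zlattice d"
    and p: "p \<in> Zlattice d" "p \<in> convex hull (insert 0 B)"
  obtains i n q where "1 \<le> i" "i + 1 \<le> (8 * (d + 1)) ^ 2 ^ (d + 1)"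
    "q \<in> Zlattice d" "q \<in> convex hull (insert 0 B)"
    "real (i + 1) *\<^sub>R p = (\<Sum>v\<in>B. real (n v) *\<^sub>R v) + q"
proof -
  let ?J = "insert 0 B"
  obtain u where u: "\<And>v. v \<in> ?J \<Longrightarrow> u v \<ge> 0" "sum u ?J = 1" "(\<Sum>v\<in>?J. u v *\<^sub>R v) = p"
    using p(2) B(1) by (auto simp: convex_hull_finite)
  have J: "finite ?J" "card ?J \<le> d + 1"
    using B by (auto simp: card_insert_if)
  obtain i n where i: "1 \<le> i" "i + 1 \<le> (8 * (d + 1)) ^ 2 ^ (d + 1)"
    and n: "\<And>v. v \<in> ?J \<Longrightarrow> real (n v) \<le> (real i + 1) * u v" "sum n ?J = i"
    by (rule apportionment[OF J u(1,2)]) (assumption, rule that)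
  define q where "q = (\<Sum>v\<in>?J. ((real i + 1) * u v - real (n v)) *\<^sub>R v)"
  have "(\<Sum>v\<in>?J. (real i + 1) * u v - real (n v)) = (real i + 1) * sum u ?J - real (sum n ?J)"
    by (simp only: sum_subtractf sum_distrib_left of_nat_sum)
  also have "\<dots> = 1"
    using u(2) n(2) by simp
  finally have "(\<Sum>v\<in>?J. (real i + 1) * u v - real (n v)) = 1" .
  then have hull: "q \<in> convex hull ?J"
    unfolding convex_hull_finite[OF J(1)] mem_Collect_eq q_def using n(1)
    by (intro exI[of _ "\<lambda>v. (real i + 1) * u v - real (n v)"] conjI) auto
  have "q = (real i + 1) *\<^sub>R p - (\<Sum>v\<in>?J. real (n v) *\<^sub>R v)"
    by (simp only: q_def u(3)[symmetric] scaleR_diff_left sum_subtractf scaleR_sum_right scaleR_scaleR)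
  \<comment> \<open>The share of the origin contributes nothing, so only points of \<open>B\<close>
    remain.\<close>
  also have "(\<Sum>v\<in>?J. real (n v) *\<^sub>R v) = (\<Sum>v\<in>B. real (n v) *\<^sub>R v)"
    using B(1) by (intro sum.mono_neutral_right) auto
  finally have q: "q = real (i + 1) *\<^sub>R p - (\<Sum>v\<in>B. real (n v) *\<^sub>R v)"
    by (simp add: add.commute)
  moreover have "\<dots> \<in> Zlattice d"
    using B p by (intro Zlattice_diff Zlattice_sum Zlattice_scaleR_of_nat) auto
  ultimately have "q \<in> Zlattice d"
    by simp
  moreover have "real (i + 1) *\<^sub>R p = (\<Sum>v\<in>B. real (n v) *\<^sub>R v) + q"
    unfolding q by simp
  ultimately show thesis
    using that i hull by blast
qed

lemma ex_lex_least_nat: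
  fixes f g :: "'a \<Rightarrow> nat"
  assumes "P x"
  obtains z where "P z" "\<And>y. P y \<Longrightarrow> f z \<le> f y" "\<And>y. P y \<Longrightarrow> f y \<le> f z \<Longrightarrow> g z \<le> g y"
proof -
  obtain z0 where z0: "P z0" "\<forall>y. P y \<longrightarrow> f z0 \<le> f y"
    using ex_has_least_nat[of P x f] assms by blast
  obtain z where "P z \<and> f z \<le> f z0" "\<forall>y. P y \<and> f y \<le> f z0 \<longrightarrow> g z \<le> g y"
    using ex_has_least_nat[of "\<lambda>y. P y \<and> f y \<le> f z0" z0 g] z0(1) by blast
  then show thesis
    using that z0 by (meson order_trans)
qed

text \<open>Turns multisets, in which exchange moves are simple, back into weight vectors on a
  finite set.\<close>

lemma sum_mset_eq_sum:
  fixes X :: "'a::real_vector multiset"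
  assumes "finite M" "set_mset X \<subseteq> M"
  shows "sum_mset X = (\<Sum>p\<in>M. real (count X p) *\<^sub>R p)"
  using assms(2)
proof (induction X)
  case (add x X)
  have "(\<Sum>p\<in>M. real (count (add_mset x X) p) *\<^sub>R p)
      = (\<Sum>p\<in>M. (if p = x then p else 0) + real (count X p) *\<^sub>R p)"
    by (intro sum.cong) (auto simp: scaleR_add_left)
  also have "\<dots> = x + sum_mset X"
    using add assms(1) by (simp add: sum.distrib)
  finally show ?case
    by simp
qed simp

text \<open>The type \<open>rvec\<close> is also a ring, and \<open>sum_mset_replicate_mset\<close> is phrased with its product.\<close>

lemma sum_mset_replicate_mset_scaleR: "sum_mset (replicate_mset n x) = real n *\<^sub>R (x :: 'a::real_vector)"
  by (induction n) (auto simp: scaleR_add_left)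

lemma sum_mset_sum: "sum_mset (\<Sum>x\<in>S. f x) = (\<Sum>x\<in>S. sum_mset (f x))"
  by (induction S rule: infinite_finite_induct) auto

lemma set_mset_sum_subset: "set_mset (\<Sum>x\<in>S. f x) \<subseteq> (\<Union>x\<in>S. set_mset (f x))"
  by (induction S rule: infinite_finite_induct) auto

text \<open>\<open>Y\<close> minimises first the number of elements outside \<open>V\<close>, with
  multiplicity, then the sum of squared norms. The first minimality bounds multiplicities through
  \<open>multiple_in_simplex\<close>, the second bounds the number of distinct elements outside
  \<open>V\<close> through midpoints.\<close>

lemma bounded_representation:
  fixes X :: "rvec multiset"
  assumes F: "finite F" "\<And>B. B \<in> F \<Longrightarrow> finite B \<and> card B \<le> d \<and> B \<subseteq> V \<inter> Zlattice d"
    and U: "U = (\<Union>B\<in>F. convex hull (insert 0 B) \<inter> Zlattice d)"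
    and X: "set_mset X \<subseteq> U"
  obtains Y where "sum_mset Y = sum_mset X" "set_mset Y \<subseteq> U"
    "\<And>p. p \<notin> V \<Longrightarrow> count Y p \<le> (8 * (d + 1)) ^ 2 ^ (d + 1)"
    "card (set_mset Y - V) \<le> card F * 2 ^ d"
proof -
  define P where "P Y \<longleftrightarrow> sum_mset Y = sum_mset X \<and> set_mset Y \<subseteq> U" for Y
  let ?f = "\<lambda>Y. size (filter_mset (\<lambda>p. p \<notin> V) Y)" and ?g = "\<lambda>Y. \<Sum>z\<in>#Y. sqnorm d z"
  have "P X"
    using X by (simp add: P_def)
  then obtain Y where Y: "P Y" and minf: "\<And>Y'. P Y' \<Longrightarrow> ?f Y \<le> ?f Y'"
    and ming: "\<And>Y'. P Y' \<Longrightarrow> ?f Y' \<le> ?f Y \<Longrightarrow> ?g Y \<le> ?g Y'"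
    by (rule ex_lex_least_nat[of P X ?f ?g]) blast
  have "count Y p \<le> (8 * (d + 1)) ^ 2 ^ (d + 1)" if "p \<notin> V" for p
  proof (rule ccontr)
    assume big: "\<not> ?thesis"
    then have "p \<in># Y"
      by (metis count_eq_zero_iff zero_le)
    then have "p \<in> U"
      using Y by (auto simp: P_def)
    then obtain B where B: "B \<in> F" "p \<in> convex hull (insert 0 B)" and p: "p \<in> Zlattice d"
      using U by auto
    have BV: "finite B" "card B \<le> d" "B \<subseteq> V" "B \<subseteq> Zlattice d"
      using F(2)[OF B(1)] by auto
    obtain i n q where i: "1 \<le> i" "i + 1 \<le> (8 * (d + 1)) ^ 2 ^ (d + 1)"
      and q: "q \<in> Zlattice d" "q \<in> convex hull (insert 0 B)"
      and eq: "real (i + 1) *\<^sub>R p = (\<Sum>v\<in>B. real (n v) *\<^sub>R v) + q"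
      by (rule multiple_in_simplex[OF BV(1,2,4) p B(2)])
    have "replicate_mset (i + 1) p \<subseteq># Y"
      using big i(2) unfolding count_le_replicate_mset_subset_eq[symmetric] by linarith
    then obtain Z where Z: "Y = Z + replicate_mset (i + 1) p"
      by (metis subset_mset.diff_add)
    define W where "W = (\<Sum>v\<in>B. replicate_mset (n v) v)"
    have "set_mset W \<subseteq> (\<Union>v\<in>B. set_mset (replicate_mset (n v) v))"
      unfolding W_def by (rule set_mset_sum_subset)
    also have "\<dots> \<subseteq> B"
      by auto
    finally have W: "set_mset W \<subseteq> B" .
    have sumW: "sum_mset W = (\<Sum>v\<in>B. real (n v) *\<^sub>R v)"
      by (simp only: W_def sum_mset_sum sum_mset_replicate_mset_scaleR)
    have "sum_mset (Z + W + {#q#}) = sum_mset Z + ((\<Sum>v\<in>B. real (n v) *\<^sub>R v) + q)"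
      by (simp add: sumW add.assoc)
    also have "\<dots> = sum_mset Y"
      unfolding eq[symmetric] Z by (simp only: sum_mset.union sum_mset_replicate_mset_scaleR)
    finally have "sum_mset (Z + W + {#q#}) = sum_mset Y" .
    moreover have "B \<subseteq> U"
      using B(1) BV(4) hull_subset[of "insert 0 B" convex] unfolding U by blast
    moreover have "set_mset Z \<subseteq> U" "q \<in> U"
      using Y Z q B(1) by (auto simp: P_def U)
    ultimately have "P (Z + W + {#q#})"
      using Y W by (auto simp: P_def)
    then have "?f Y \<le> ?f (Z + W + {#q#})"
      by (rule minf)
    \<comment> \<open>The trade adds only points of \<open>V\<close> and \<open>q\<close>, so at
      most one element outside \<open>V\<close>, and removes \<open>i + 1\<close> such elements;
      \<open>i \<ge> 1\<close> makes this a strict gain.\<close>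
    moreover have "filter_mset (\<lambda>p. p \<notin> V) W = {#}"
      using W BV(3) by auto
    then have "?f (Z + W + {#q#}) \<le> ?f Z + 1"
      by (simp only: filter_union_mset size_union) simp
    moreover have "filter_mset (\<lambda>p. p \<notin> V) (replicate_mset (i + 1) p) = replicate_mset (i + 1) p"
      using that by (intro multiset_eqI) auto
    then have "?f Y = ?f Z + (i + 1)"
      by (simp only: Z filter_union_mset size_union size_replicate_mset)
    ultimately show False
      using i(1) by simp
  qed
  moreover have "card (set_mset Y - V) \<le> card F * 2 ^ d"
  proof -
    \<comment> \<open>The count is done hull by hull: a midpoint stays in the same convex hull,
      while the union \<open>U\<close> need not be convex.\<close>
    have "set_mset Y - V \<subseteq> (\<Union>B\<in>F. (set_mset Y - V) \<inter> convex hull (insert 0 B))"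
      using Y U by (auto simp: P_def)
    then have "card (set_mset Y - V) \<le> card (\<Union>B\<in>F. (set_mset Y - V) \<inter> convex hull (insert 0 B))"
      using F(1) by (intro card_mono) auto
    also have "\<dots> \<le> (\<Sum>B\<in>F. card ((set_mset Y - V) \<inter> convex hull (insert 0 B)))"
      using F(1) by (rule card_UN_le)
    also have "\<dots> \<le> (\<Sum>B\<in>F. 2 ^ d)"
    proof (intro sum_mono card_inj_on_parity inj_onI, rule ccontr)
      fix B x y
      assume B: "B \<in> F" and x: "x \<in> (set_mset Y - V) \<inter> convex hull (insert 0 B)"
        and y: "y \<in> (set_mset Y - V) \<inter> convex hull (insert 0 B)"
        and par: "parity d x = parity d y" and "x \<noteq> y"
      have mem: "x \<in> Zlattice d" "y \<in> Zlattice d"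
        using x y Y U by (auto simp: P_def)
      obtain Z where Z: "Y = Z + {#x, y#}"
        "sum_mset (Z + {#midpoint x y, midpoint x y#}) = sum_mset Y"
        "?g (Z + {#midpoint x y, midpoint x y#}) < ?g Y"
        by (rule midpoint_exchange[of x Y y d]) (use x y \<open>x \<noteq> y\<close> par mem in auto)
      have "midpoint x y \<in> convex hull (insert 0 B)"
        using convexD_alt[OF convex_convex_hull, of x "insert 0 B" y "1/2"] x y
        by (simp add: midpoint_def scaleR_add_right)
      moreover have "midpoint x y \<in> Zlattice d"
        using mem par by (intro midpoint_in_Zlattice) auto
      ultimately have "P (Z + {#midpoint x y, midpoint x y#})"
        using Y Z(1,2) B by (auto simp: P_def U)
      \<comment> \<open>Both \<open>x\<close> and \<open>y\<close> lie outside \<open>V\<close>, so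
        two copies of the midpoint cannot raise the first objective, whether or not the midpoint is
        in \<open>V\<close>.\<close>
      moreover have "?f (Z + {#midpoint x y, midpoint x y#}) \<le> ?f Y"
        using x y by (simp add: Z(1))
      ultimately show False
        using ming Z(3) by (meson not_less)
    qed
    finally show ?thesis
      by simp
  qed
  ultimately show thesis
    using that Y by (auto simp: P_def)
qed

section \<open>Numerical bound and assembly of the representation\<close>

text \<open>Rests on \<open>8 * (d + 1) \<le> 2 ^ (d + 3)\<close> and
  \<open>d + 3 \<le> 2 ^ (d + 2)\<close>; the resulting exponent \<open>2 * d + 3\<close> is at most
  \<open>5 * d\<close> as soon as \<open>d \<ge> 1\<close>, which is the source of the constant
  5.\<close>

lemma doubly_exponential_bound:
  assumes "1 \<le> (d::nat)"
  shows "real ((8 * (d + 1)) ^ 2 ^ (d + 1)) \<le> 2 powr (2 powr (5 * real d))"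
proof -
  have "d + 1 \<le> 2 ^ d"
    using less_exp[of d] by linarith
  then have "8 * (d + 1) \<le> 2 ^ (d + 3)"
    by (simp add: power_add)
  then have "(8 * (d + 1)) ^ 2 ^ (d + 1) \<le> (2 ^ (d + 3)) ^ 2 ^ (d + 1)"
    by (rule power_mono) simp
  also have "\<dots> = (2::nat) ^ ((d + 3) * 2 ^ (d + 1))"
    by (rule power_mult[symmetric])
  also have "\<dots> \<le> 2 ^ 2 ^ (5 * d)"
  proof (rule power_increasing)
    have "d + 3 \<le> 2 ^ (d + 2)"
      using less_exp[of "d + 2"] by linarith
    then have "(d + 3) * 2 ^ (d + 1) \<le> (2::nat) ^ (d + 2) * 2 ^ (d + 1)"
      by (rule mult_right_mono) simp
    also have "\<dots> = 2 ^ (2 * d + 3)"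
      unfolding power_add[symmetric] by (rule arg_cong) simp
    also have "\<dots> \<le> 2 ^ (5 * d)"
      using assms by (intro power_increasing) auto
    finally show "(d + 3) * 2 ^ (d + 1) \<le> (2::nat) ^ (5 * d)" .
  qed simp
  finally have "real ((8 * (d + 1)) ^ 2 ^ (d + 1)) \<le> real (2 ^ 2 ^ (5 * d))"
    by (simp only: of_nat_le_iff)
  also have "\<dots> = 2 powr real (2 ^ (5 * d))"
    by (subst powr_realpow) simp_all
  also have "real (2 ^ (5 * d)) = 2 powr (5 * real d)"
    using powr_realpow[of 2 "5 * d"] by simp
  finally show ?thesis .
qed

text \<open>\<open>small_support\<close> leaves at most \<open>2 ^ d\<close> points, each gets a set
  of at most \<open>d\<close> vertices by \<open>Caratheodory_origin\<close>, and
  \<open>bounded_representation\<close> works with these at most \<open>2 ^ d\<close> sets. Clearing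
  the weight of the origin serves the vertex count and dimension 0.\<close>

lemma integer_cone_representation:
  assumes P: "polytope P" "0 \<in> P" and M: "M = P \<inter> Zlattice d" and V: "V = vertices (convex hull M)"
    and b: "b \<in> int_cone M"
  obtains \<mu> :: "rvec \<Rightarrow> nat" where "b = (\<Sum>p\<in>M. real (\<mu> p) *\<^sub>R p)"
    "\<And>p. p \<notin> V \<Longrightarrow> \<mu> p \<le> (8 * (d + 1)) ^ 2 ^ (d + 1)"
    "card (supp M \<mu> \<inter> V) \<le> d * 2 ^ d" "card (supp M \<mu> - V) \<le> 2 ^ (2 * d)" "\<mu> 0 = 0"
proof -
  have finM: "finite M"
    unfolding M using P(1) by (rule finite_lattice_points)
  have "convex P"
    using P(1) by (rule polytope_imp_convex)
  then have hullM: "convex hull M \<inter> Zlattice d \<subseteq> M"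
    unfolding M using hull_minimal[of "P \<inter> Zlattice d" P convex] by auto
  have M0: "0 \<in> M"
    using P(2) zero_in_Zlattice by (simp add: M)
  have VM: "V \<subseteq> M"
    by (auto simp: V vertices_def dest: extreme_point_of_convex_hull)
  have hullV: "convex hull V = convex hull M"
    using Krein_Milman_finite[OF finM] by (simp add: V vertices_def)
  obtain \<nu> :: "rvec \<Rightarrow> nat" where \<nu>: "b = (\<Sum>p\<in>M. real (\<nu> p) *\<^sub>R p)"
    using b by (auto simp: int_cone_def)
  define X0 where "X0 = (\<Sum>p\<in>M. replicate_mset (\<nu> p) p)"
  have "set_mset X0 \<subseteq> (\<Union>p\<in>M. set_mset (replicate_mset (\<nu> p) p))"
    unfolding X0_def by (rule set_mset_sum_subset)
  also have "\<dots> \<subseteq> P \<inter> Zlattice d"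
    by (auto simp: M)
  finally have X0: "set_mset X0 \<subseteq> P \<inter> Zlattice d" .
  have sumX0: "sum_mset X0 = b"
    by (simp only: X0_def \<nu> sum_mset_sum sum_mset_replicate_mset_scaleR)
  obtain X where X: "sum_mset X = b" "set_mset X \<subseteq> M" "card (set_mset X) \<le> 2 ^ d"
    using small_support[OF \<open>convex P\<close> X0] sumX0 M by metis
  have "\<exists>B. B \<subseteq> V \<and> card B \<le> d \<and> p \<in> convex hull (insert 0 B)" if "p \<in> M" for p
  proof -
    have "finite V"
      using VM finM by (rule finite_subset)
    moreover have "V \<subseteq> Rspace d"
      using VM by (auto simp: M Zlattice_def)
    moreover have "p \<in> convex hull (insert 0 V)"
      using that hull_subset[of M convex] hull_mono[of V "insert 0 V" convex] hullV by auto
    ultimately show ?thesis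
      by (rule Caratheodory_origin) blast
  qed
  then obtain S where S: "\<And>p. p \<in> M \<Longrightarrow> S p \<subseteq> V \<and> card (S p) \<le> d \<and> p \<in> convex hull (insert 0 (S p))"
    by metis
  define F where "F = S ` set_mset X"
  define U where "U = (\<Union>B\<in>F. convex hull (insert 0 B) \<inter> Zlattice d)"
  have finF: "finite F"
    by (simp add: F_def)
  have cardF: "card F \<le> 2 ^ d"
    unfolding F_def using X(3) card_image_le[of "set_mset X" S] by simp
  have FB: "finite B \<and> card B \<le> d \<and> B \<subseteq> V \<inter> Zlattice d" if "B \<in> F" for B
  proof -
    have "B \<subseteq> V" "card B \<le> d"
      using that S X(2) by (auto simp: F_def)
    moreover have "finite B"
      using \<open>B \<subseteq> V\<close> VM finM by (meson finite_subset)
    ultimately show ?thesis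
      using VM by (auto simp: M)
  qed
  have XU: "set_mset X \<subseteq> U"
    using S X(2) by (fastforce simp: U_def F_def M)
  obtain Y where Y: "sum_mset Y = sum_mset X" "set_mset Y \<subseteq> U"
    "\<And>p. p \<notin> V \<Longrightarrow> count Y p \<le> (8 * (d + 1)) ^ 2 ^ (d + 1)"
    "card (set_mset Y - V) \<le> card F * 2 ^ d"
    by (rule bounded_representation[OF finF FB U_def XU]) (assumption, rule that)
  have hullB: "convex hull (insert 0 B) \<subseteq> convex hull M" if "B \<in> F" for B
    using FB[OF that] VM M0 by (intro hull_mono) auto
  have "U \<subseteq> M"
    using hullB hullM by (auto simp: U_def)
  \<comment> \<open>A vertex of \<open>convex hull M\<close> in the smaller hull of
    \<open>insert 0 B\<close> is extreme there too, hence one of the generators.\<close>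
  have UV: "U \<inter> V \<subseteq> insert 0 (\<Union>F)"
  proof
    fix v
    assume v: "v \<in> U \<inter> V"
    then obtain B where B: "B \<in> F" "v \<in> convex hull (insert 0 B)"
      by (auto simp: U_def)
    have "v extreme_point_of (convex hull M)"
      using v by (simp add: V vertices_def)
    then have "v extreme_point_of (convex hull (insert 0 B))"
      using hullB[OF B(1)] B(2) by (auto simp: extreme_point_of_def)
    then have "v \<in> insert 0 B"
      by (rule extreme_point_of_convex_hull)
    then show "v \<in> insert 0 (\<Union>F)"
      using B(1) by auto
  qed
  \<comment> \<open>The origin adds nothing to the sum, but as a vertex outside
    \<open>\<Union>F\<close> it could break the bound \<open>d * 2 ^ d\<close>. With weight 0 it
    leaves the support.\<close>
  define \<mu> where "\<mu> = (count Y)(0 := 0)"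
  have "b = (\<Sum>p\<in>M. real (count Y p) *\<^sub>R p)"
    using sum_mset_eq_sum[OF finM] Y(1,2) \<open>U \<subseteq> M\<close> X(1) by simp
  also have "\<dots> = (\<Sum>p\<in>M. real (\<mu> p) *\<^sub>R p)"
    by (intro sum.cong) (auto simp: \<mu>_def)
  finally have "b = (\<Sum>p\<in>M. real (\<mu> p) *\<^sub>R p)" .
  moreover have "\<mu> p \<le> (8 * (d + 1)) ^ 2 ^ (d + 1)" if "p \<notin> V" for p
    using Y(3)[OF that] by (simp add: \<mu>_def)
  moreover have "card (supp M \<mu> \<inter> V) \<le> d * 2 ^ d"
  proof -
    have "supp M \<mu> \<inter> V \<subseteq> \<Union>F"
      using UV Y(2) by (auto simp: supp_def \<mu>_def count_eq_zero_iff split: if_splits)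
    moreover have "finite (\<Union>F)"
      using finF FB by blast
    ultimately have "card (supp M \<mu> \<inter> V) \<le> card (\<Union>F)"
      by (intro card_mono)
    also have "\<dots> \<le> (\<Sum>B\<in>F. card B)"
      using card_UN_le[OF finF, of "\<lambda>B. B"] by simp
    also have "\<dots> \<le> card F * d"
      using FB sum_bounded_above[of F card d] by auto
    also have "\<dots> \<le> d * 2 ^ d"
      using cardF by simp
    finally show ?thesis .
  qed
  moreover have "card (supp M \<mu> - V) \<le> 2 ^ (2 * d)"
  proof -
    have "card (supp M \<mu> - V) \<le> card (set_mset Y - V)"
      by (intro card_mono) (auto simp: supp_def \<mu>_def count_eq_zero_iff split: if_splits)
    also have "\<dots> \<le> card F * 2 ^ d"
      by (rule Y(4))
    also have "\<dots> \<le> 2 ^ d * 2 ^ d"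
      using cardF by simp
    also have "\<dots> = 2 ^ (2 * d)"
      by (simp add: mult_2 power_add)
    finally show ?thesis .
  qed
  moreover have "\<mu> 0 = 0"
    by (simp add: \<mu>_def)
  ultimately show thesis
    using that by blast
qed

theorem theorem5:
  shows "\<exists>C::real. C > 0 \<and>
    (\<forall>(d::nat) (m::nat) (A :: nat \<Rightarrow> nat \<Rightarrow> int) (c :: nat \<Rightarrow> int) P M V b.
       (\<forall>i<m. c i \<ge> 0) \<longrightarrow>
       P = ineq_set m d A c \<longrightarrow>
       polytope P \<longrightarrow>
       M = P \<inter> Zlattice d \<longrightarrow>
       V = vertices (convex hull M) \<longrightarrow>
       b \<in> int_cone M \<longrightarrow>
       (\<exists>\<mu> :: rvec \<Rightarrow> nat.
          b = (\<Sum>p\<in>M. real (\<mu> p) *\<^sub>R p) \<and>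
          (\<forall>p \<in> M - V. real (\<mu> p) \<le> 2 powr (2 powr (C * real d))) \<and>
          card (supp M \<mu> \<inter> V) \<le> d * 2 ^ d \<and>
          card (supp M \<mu> - V) \<le> 2 ^ (2 * d)))"
proof (intro exI[of _ 5] conjI allI impI)
  fix d m A c P M V b
  assume c: "\<forall>i<m. (0::int) \<le> c i" and P: "P = ineq_set m d A c" "polytope P"
    and M: "M = P \<inter> Zlattice d" and V: "V = vertices (convex hull M)" and b: "b \<in> int_cone M"
  \<comment> \<open>The origin satisfies all inequalities because \<open>c\<close> is nonnegative;
    this keeps the hulls of \<open>insert 0 B\<close> inside \<open>convex hull M\<close>.\<close>
  have "0 \<in> P"
    using c subspace_0[OF subspace_Rspace] by (simp add: P ineq_set_def)
  then obtain \<mu> :: "rvec \<Rightarrow> nat" where \<mu>: "b = (\<Sum>p\<in>M. real (\<mu> p) *\<^sub>R p)"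
    "\<And>p. p \<notin> V \<Longrightarrow> \<mu> p \<le> (8 * (d + 1)) ^ 2 ^ (d + 1)"
    "card (supp M \<mu> \<inter> V) \<le> d * 2 ^ d" "card (supp M \<mu> - V) \<le> 2 ^ (2 * d)" "\<mu> 0 = 0"
    by (rule integer_cone_representation[OF P(2) _ M V b]) (rule that)
  have "real (\<mu> p) \<le> 2 powr (2 powr (5 * real d))" if p: "p \<in> M - V" for p
  proof (cases "d = 0")
    \<comment> \<open>In dimension 0 the right-hand side is only 2, but the sole lattice point is
      the origin, whose weight is 0.\<close>
    case True
    then have "p = 0"
      using p by (intro Zlattice_eqI[of _ d] zero_in_Zlattice) (auto simp: M)
    then show ?thesis
      using \<mu>(5) by simp
  next
    case False
    then show ?thesis
      using \<mu>(2)[of p] p doubly_exponential_bound[of d] by (simp add: order_trans[rotated] del: of_nat_power of_nat_mult)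
  qed
  then show "\<exists>\<mu> :: rvec \<Rightarrow> nat.
          b = (\<Sum>p\<in>M. real (\<mu> p) *\<^sub>R p) \<and>
          (\<forall>p \<in> M - V. real (\<mu> p) \<le> 2 powr (2 powr (5 * real d))) \<and>
          card (supp M \<mu> \<inter> V) \<le> d * 2 ^ d \<and>
          card (supp M \<mu> - V) \<le> 2 ^ (2 * d)"
    using \<mu>(1,3,4) by blast
qed simp

end
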